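(* Consider the following conditions on a finite list (multiset) of real numbers, each defined in the context: condition (C) (the cone condition), "Suleimanova spectrum", Ciarlet's condition, Suleimanova's condition, Salzmann's condition, and Perfect's condition 1. Then: 1. Condition (C) is independent of Ciarlet's condition. 2. Condition (C) is independent of Perfect's condition 1. 3. Being a Suleimanova spectrum is independent of Ciarlet's condition. 4. Every Suleimanova spectrum satisfies condition (C), and the inclusion is strict. 5. Every list satisfying condition (C) satisfies Suleimanova's condition, and the inclusion is strict. 6. Every list satisfying condition (C) satisfies Salzmann's condition, and the inclusion is strict. Here "independent" means that neither condition implies the other (there is a list satisfying the first but not the second, and a list satisfying the second but not the first), and "strict" means that there is a list satisfying the second condition but not the first.
   Context: A list is a finite nonempty multiset of real numbers; it satisfies one of the conditions below if its elements can be indexed so that the condition holds. Write $s_1(\Lambda)$ for the sum of the elements of $\Lambda$. - Condition (C): $\Lambda=\{\lambda_1,\dots,\lambda_n\}$ with $s_1(\Lambda)\ge 0$ and $s_1(\Lambda)-n\lambda_i\ge 0$ for all $i\in\{2,\dots,n\}$. - Suleimanova spectrum: $s_1(\Lambda)\ge0$ and $\Lambda$ contains exactly one positive element. - Ciarlet's condition: $\Lambda=\{\lambda_1,\dots,\lambda_n\}$ with $\lambda_1\ge|\lambda_i|$ for all $i$ and $|\lambda_i|\le\frac{\lambda_1}{n-1}$ for all $i\in\{2,\dots,n\}$. - Suleimanova's condition: $\Lambda=\{\lambda_1,\dots,\lambda_n\}$ with $\lambda_1\ge|\lambda_i|$ for all $i$ and $\lambda_1+\sum_{\lambda_i<0}\lambda_i\ge0$.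 - Salzmann's condition: $\Lambda=\{\lambda_1,\dots,\lambda_n\}$ with $\lambda_1\ge\lambda_2\ge\dots\ge\lambda_n$, $\sum_{i=1}^n\lambda_i\ge0$, and $\lambda_k+\lambda_{n-k+1}\le\frac2n\sum_{i=1}^n\lambda_i$ for all integers $k$ with $2\le k\le\lfloor(n+1)/2\rfloor$. - Perfect's condition 1: $\Lambda=\{\lambda_0,\lambda_1,\lambda_{11},\dots,\lambda_{1t_1},\dots,\lambda_r,\lambda_{r1},\dots,\lambda_{rt_r},\delta\}$ for some integers $r\ge0$ and $t_1,\dots,t_r\ge0$ (empty sums being $0$), where $\lambda_0\ge|\lambda|$ for all $\lambda\in\Lambda$, $\sum_{\lambda\in\Lambda}\lambda\ge0$, $\delta\le0$, $\lambda_j\ge0$ and $\lambda_{ji}\le0$ for all $1\le j\le r$, $1\le i\le t_j$, and, for every $1\le j\le r$, $\lambda_j+\delta\le0$ and $\lambda_j+\sum_{i=1}^{t_j}\lambda_{ji}\le0$. *)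

theory Defs
  imports Complex_Main "HOL-Library.Multiset"
begin

text \<open>Lists of reals in the sense of the inverse eigenvalue problem are represented as multisets;
  nonemptiness is imposed where the conditions are compared (\<open>mutually_independent\<close>, \<open>strictly_implies\<close>).
  \<open>indexing \<Lambda> l\<close> states that \<open>l 1, \<dots>, l n\<close>, with \<open>n = size \<Lambda>\<close>, enumerates \<open>\<Lambda>\<close> with multiplicity.\<close>

definition indexing :: "real multiset \<Rightarrow> (nat \<Rightarrow> real) \<Rightarrow> bool" where
  "indexing \<Lambda> l \<longleftrightarrow> \<Lambda> = image_mset l (mset_set {1..size \<Lambda>})"

definition condition_C :: "real multiset \<Rightarrow> bool" where
  "condition_C \<Lambda> \<longleftrightarrow> (\<exists>l. indexing \<Lambda> l \<and> sum_mset \<Lambda> \<ge> 0 \<and>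
     (\<forall>i\<in>{2..size \<Lambda>}. sum_mset \<Lambda> - real (size \<Lambda>) * l i \<ge> 0))"

text \<open>Positive elements are counted with multiplicity.\<close>

definition suleimanova_spectrum :: "real multiset \<Rightarrow> bool" where
  "suleimanova_spectrum \<Lambda> \<longleftrightarrow> sum_mset \<Lambda> \<ge> 0 \<and> size (filter_mset (\<lambda>x. x > 0) \<Lambda>) = 1"

definition ciarlet_condition :: "real multiset \<Rightarrow> bool" where
  "ciarlet_condition \<Lambda> \<longleftrightarrow> (\<exists>l. indexing \<Lambda> l \<and>
     (\<forall>i\<in>{1..size \<Lambda>}. l 1 \<ge> \<bar>l i\<bar>) \<and>
     (\<forall>i\<in>{2..size \<Lambda>}. \<bar>l i\<bar> \<le> l 1 / (real (size \<Lambda>) - 1)))"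

definition suleimanova_condition :: "real multiset \<Rightarrow> bool" where
  "suleimanova_condition \<Lambda> \<longleftrightarrow> (\<exists>l. indexing \<Lambda> l \<and>
     (\<forall>i\<in>{1..size \<Lambda>}. l 1 \<ge> \<bar>l i\<bar>) \<and>
     l 1 + (\<Sum>i | i \<in> {1..size \<Lambda>} \<and> l i < 0. l i) \<ge> 0)"

definition salzmann_condition :: "real multiset \<Rightarrow> bool" where
  "salzmann_condition \<Lambda> \<longleftrightarrow> (\<exists>l. let n = size \<Lambda> in indexing \<Lambda> l \<and>
     antimono_on {1..n} l \<and>
     (\<Sum>i=1..n. l i) \<ge> 0 \<and>
     (\<forall>k\<in>{2..(n + 1) div 2}. l k + l (n - k + 1) \<le> 2 / real n * (\<Sum>i=1..n. l i)))"

text \<open>Below \<open>a j\<close> is $\lambda_j$ for $0 \le j \le r$, and \<open>b j i\<close> is $\lambda_{ji}$ for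
  $1 \le j \le r$ and $1 \le i \le t_j$.\<close>

definition perfect_condition_1 :: "real multiset \<Rightarrow> bool" where
  "perfect_condition_1 \<Lambda> \<longleftrightarrow>
     (\<exists>(r::nat) (t :: nat \<Rightarrow> nat) (a :: nat \<Rightarrow> real) (b :: nat \<Rightarrow> nat \<Rightarrow> real) (\<delta>::real).
        \<Lambda> = {#a 0#}
            + (\<Sum>j=1..r. {#a j#} + image_mset (b j) (mset_set {1..t j}))
            + {#\<delta>#} \<and>
        (\<forall>x\<in>#\<Lambda>. a 0 \<ge> \<bar>x\<bar>) \<and>
        sum_mset \<Lambda> \<ge> 0 \<and>
        \<delta> \<le> 0 \<and>
        (\<forall>j\<in>{1..r}. a j \<ge> 0) \<and>
        (\<forall>j\<in>{1..r}. \<forall>i\<in>{1..t j}. b j i \<le> 0) \<and>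
        (\<forall>j\<in>{1..r}. a j + \<delta> \<le> 0 \<and> a j + (\<Sum>i=1..t j. b j i) \<le> 0))"

definition mutually_independent ::
  "(real multiset \<Rightarrow> bool) \<Rightarrow> (real multiset \<Rightarrow> bool) \<Rightarrow> bool" where
  "mutually_independent P Q \<longleftrightarrow>
     (\<exists>\<Lambda>. \<Lambda> \<noteq> {#} \<and> P \<Lambda> \<and> \<not> Q \<Lambda>) \<and> (\<exists>\<Lambda>. \<Lambda> \<noteq> {#} \<and> Q \<Lambda> \<and> \<not> P \<Lambda>)"

definition strictly_implies ::
  "(real multiset \<Rightarrow> bool) \<Rightarrow> (real multiset \<Rightarrow> bool) \<Rightarrow> bool" where
  "strictly_implies P Q \<longleftrightarrow>
     (\<forall>\<Lambda>. \<Lambda> \<noteq> {#} \<longrightarrow> P \<Lambda> \<longrightarrow> Q \<Lambda>) \<and> (\<exists>\<Lambda>. \<Lambda> \<noteq> {#} \<and> Q \<Lambda> \<and> \<not> P \<Lambda>)"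

end

theory Submission
  imports Defs
begin

text \<open>Put \<open>m = s\<^sub>1(\<Lambda>) / n\<close>. Under (C) all elements but \<open>\<lambda>\<^sub>1\<close> are at most the mean \<open>m \<ge> 0\<close>, so
  \<open>\<lambda>\<^sub>1 \<ge> m\<close>. Each pair in Salzmann's condition avoids \<open>\<lambda>\<^sub>1\<close> and hence sums to at most \<open>2 m\<close>, while
  the positive elements other than \<open>\<lambda>\<^sub>1\<close> sum to at most \<open>(n - 1) m \<le> s\<^sub>1(\<Lambda>)\<close>, which is
  Suleimanova's condition. Three lists suffice for all the separations: \<open>{3, 1, -1, -1}\<close> satisfies
  every condition except (C) and being a Suleimanova spectrum, \<open>{1, -1, 0}\<close> is a Suleimanova
  spectrum that violates Ciarlet's condition, and \<open>{1, 1}\<close> satisfies (C) but is not a Suleimanova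
  spectrum and has no nonpositive element to play the role of \<open>\<delta>\<close> in Perfect's condition 1.\<close>

section \<open>Indexings and an index-free form of (C)\<close>

text \<open>Lists count from 0 and indexings from 1, hence the shift. Concrete indexings are all
  obtained this way.\<close>

lemma indexing_nth: "indexing (mset xs) (\<lambda>i. xs ! (i - 1))"
proof -
  have "mset xs = image_mset ((!) xs) (mset_set {0..<length xs})"
    by (metis map_nth mset_map mset_upt)
  moreover have "mset_set {1..length xs} = image_mset Suc (mset_set {0..<length xs})"
    by (simp add: image_mset_mset_set image_Suc_atLeastLessThan atLeastLessThanSuc_atLeastAtMost)
  ultimately show ?thesis
    by (simp add: indexing_def image_mset.compositionality comp_def)
qed

lemma indexing_sum:
  assumes "indexing \<Lambda> l"
  shows "sum_mset \<Lambda> = (\<Sum>i=1..size \<Lambda>. l i)"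
  using assms unfolding indexing_def by (metis sum_unfold_sum_mset)

lemma indexing_split_first:
  assumes "indexing \<Lambda> l" "\<Lambda> \<noteq> {#}"
  shows "\<Lambda> = add_mset (l 1) (image_mset l (mset_set {2..size \<Lambda>}))"
proof -
  have "1 \<le> size \<Lambda>"
    using assms(2) by (simp add: Suc_leI nonempty_has_size)
  then have "{1..size \<Lambda>} = insert 1 {2..size \<Lambda>}"
    by auto
  then show ?thesis
    using assms(1) by (simp add: indexing_def)
qed

text \<open>(C) singles out only index 1, so an indexing amounts to choosing the exempt element
  \<open>x\<close>; the order of the rest \<open>M\<close> is irrelevant. This form is convenient
  for both proving and refuting (C).\<close>

lemma condition_C_iff:
  assumes "\<Lambda> \<noteq> {#}"
  shows "condition_C \<Lambda> \<longleftrightarrow> sum_mset \<Lambda> \<ge> 0 \<and>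
    (\<exists>x M. \<Lambda> = add_mset x M \<and> (\<forall>y\<in>#M. real (size \<Lambda>) * y \<le> sum_mset \<Lambda>))"
    (is "_ \<longleftrightarrow> ?R")
proof
  assume "condition_C \<Lambda>"
  then obtain l where l: "indexing \<Lambda> l" "sum_mset \<Lambda> \<ge> 0"
    "\<forall>i\<in>{2..size \<Lambda>}. sum_mset \<Lambda> - real (size \<Lambda>) * l i \<ge> 0"
    by (auto simp: condition_C_def)
  have "\<forall>y\<in>#image_mset l (mset_set {2..size \<Lambda>}). real (size \<Lambda>) * y \<le> sum_mset \<Lambda>"
    using l(3) by auto
  then show ?R
    using indexing_split_first[OF l(1) assms] l(2) by blast
next
  assume ?R
  then obtain x M where M: "sum_mset \<Lambda> \<ge> 0" "\<Lambda> = add_mset x M"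
    "\<forall>y\<in>#M. real (size \<Lambda>) * y \<le> sum_mset \<Lambda>"
    by blast
  obtain xs where xs: "mset xs = M"
    using ex_mset by blast
  have "indexing \<Lambda> (\<lambda>i. (x # xs) ! (i - 1))"
    using indexing_nth[of "x # xs"] M(2) xs by simp
  moreover have "sum_mset \<Lambda> - real (size \<Lambda>) * ((x # xs) ! (i - 1)) \<ge> 0" if "i \<in> {2..size \<Lambda>}" for i
  proof -
    have "(x # xs) ! (i - 1) = xs ! (i - 2)" "i - 2 < length xs"
      using that M(2) xs by (auto simp: nth_Cons' numeral_2_eq_2)
    then have "(x # xs) ! (i - 1) \<in># M"
      using xs by (metis nth_mem_mset)
    then show ?thesis
      using M(3) by fastforce
  qed
  ultimately show "condition_C \<Lambda>"
    unfolding condition_C_def using M(1) by blast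
qed

text \<open>The other elements do not exceed the mean, so the remaining one cannot lie below
  it.\<close>

lemma first_ge_mean:
  fixes x :: real
  assumes "\<forall>y\<in>#M. real (size (add_mset x M)) * y \<le> sum_mset (add_mset x M)"
  shows "sum_mset (add_mset x M) \<le> real (size (add_mset x M)) * x"
proof -
  define s n where "s = sum_mset (add_mset x M)" and "n = real (size (add_mset x M))"
  have "n > 0"
    by (simp add: n_def)
  \<comment> \<open>\<open>s\<close> and \<open>n\<close> depend on \<open>M\<close>, so the
    induction runs over a separate \<open>N\<close> with the mean kept fixed.\<close>
  have "sum_mset N \<le> real (size N) * (s / n)" if "\<forall>y\<in>#N. y \<le> s / n" for N
    using that by (induction N) (auto simp: algebra_simps)
  moreover have "\<forall>y\<in>#M. y \<le> s / n"
    using assms \<open>n > 0\<close> by (simp add: s_def n_def field_simps)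
  ultimately have "s - x \<le> (n - 1) * (s / n)"
    by (auto simp: s_def n_def)
  then show ?thesis
    using \<open>n > 0\<close> unfolding s_def[symmetric] n_def[symmetric] by (simp add: field_simps)
qed

section \<open>The three inclusions\<close>

text \<open>The unique positive element is the exempt one; all others are nonpositive and hence at
  most the nonnegative mean.\<close>

lemma suleimanova_spectrum_imp_condition_C:
  assumes "\<Lambda> \<noteq> {#}" "suleimanova_spectrum \<Lambda>"
  shows "condition_C \<Lambda>"
proof -
  have s: "sum_mset \<Lambda> \<ge> 0" and "size (filter_mset (\<lambda>x. x > 0) \<Lambda>) = 1"
    using assms(2) by (auto simp: suleimanova_spectrum_def)
  then obtain x where x: "filter_mset (\<lambda>x. x > 0) \<Lambda> = {#x#}"
    using size_1_singleton_mset by blast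
  define M where "M = filter_mset (\<lambda>x. \<not> x > 0) \<Lambda>"
  have "\<Lambda> = add_mset x M"
    using multiset_partition[of \<Lambda> "\<lambda>x. x > 0"] x by (simp add: M_def)
  moreover have "real (size \<Lambda>) * y \<le> sum_mset \<Lambda>" if "y \<in># M" for y
  proof -
    have "y \<le> 0"
      using that by (simp add: M_def)
    then show ?thesis
      using s by (meson mult_nonneg_nonpos of_nat_0_le_iff order_trans)
  qed
  ultimately show ?thesis
    using condition_C_iff[OF assms(1)] s by blast
qed

lemma condition_C_imp_suleimanova_condition:
  assumes "\<Lambda> \<noteq> {#}" "condition_C \<Lambda>"
  shows "suleimanova_condition \<Lambda>"
proof -
  obtain l where l: "indexing \<Lambda> l" and s: "sum_mset \<Lambda> \<ge> 0"
    and l_le: "\<And>i. i \<in> {2..size \<Lambda>} \<Longrightarrow> sum_mset \<Lambda> - real (size \<Lambda>) * l i \<ge> 0"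
    using assms(2) by (auto simp: condition_C_def)
  define n where "n = size \<Lambda>"
  define m where "m = sum_mset \<Lambda> / real n"
  have n: "n \<ge> 1"
    using assms(1) by (simp add: n_def Suc_leI nonempty_has_size)
  have m: "m \<ge> 0" "sum_mset \<Lambda> = real n * m"
    using s n by (auto simp: m_def)
  have le_m: "l i \<le> m" if "i \<in> {2..n}" for i
    using l_le[of i] that n by (simp add: m_def n_def field_simps)
  have ivl: "{1..n} = insert 1 {2..n}"
    using n by auto
  \<comment> \<open>\<open>min (l i) 0\<close> keeps the negative elements. A negative
    \<open>l i\<close> gains \<open>m \<ge> 0\<close>, and any other is at most
    \<open>m\<close>.\<close>
  have "sum l {2..n} \<le> (\<Sum>i\<in>{2..n}. min (l i) 0 + m)"
    using le_m m(1) by (intro sum_mono) (auto simp: min_def)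
  also have "\<dots> = (\<Sum>i\<in>{2..n}. min (l i) 0) + (real n - 1) * m"
    using n by (simp add: sum.distrib of_nat_diff)
  finally have "sum l {2..n} \<le> (\<Sum>i\<in>{2..n}. min (l i) 0) + (real n - 1) * m" .
  moreover have "l 1 + sum l {2..n} = real n * m"
    using indexing_sum[OF l] m(2) ivl by (simp add: n_def)
  \<comment> \<open>The total is \<open>n * m\<close> and the loss is \<open>(n - 1) * m\<close>, so
    one \<open>m\<close> is left over.\<close>
  ultimately have key: "l 1 + (\<Sum>i\<in>{2..n}. min (l i) 0) \<ge> m"
    by (simp add: algebra_simps)
  moreover have "(\<Sum>i\<in>{2..n}. min (l i) 0) \<le> 0"
    by (intro sum_nonpos) auto
  ultimately have l1: "l 1 \<ge> m"
    by linarith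
  have "(\<Sum>i | i \<in> {1..n} \<and> l i < 0. l i) = (\<Sum>i\<in>{1..n}. if l i < 0 then l i else 0)"
    by (intro sum.inter_filter) simp
  also have "\<dots> = (\<Sum>i\<in>{1..n}. min (l i) 0)"
    by (intro sum.cong) (auto simp: min_def)
  also have "\<dots> = (\<Sum>i\<in>{2..n}. min (l i) 0)"
    using ivl l1 m(1) by simp
  finally have "l 1 + (\<Sum>i | i \<in> {1..n} \<and> l i < 0. l i) \<ge> 0"
    using key m(1) by linarith
  moreover have "l 1 \<ge> \<bar>l i\<bar>" if "i \<in> {1..n}" for i
  proof (cases "i = 1")
    case True
    then show ?thesis
      using l1 m(1) by simp
  next
    case False
    then have i: "i \<in> {2..n}"
      using that by auto
    \<comment> \<open>A single negative part is bounded by all of them together, which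
      \<open>key\<close> bounds by \<open>l 1 - m\<close>.\<close>
    have "- min (l i) 0 \<le> (\<Sum>i\<in>{2..n}. - min (l i) 0)"
      using i by (intro member_le_sum) auto
    then have "l 1 \<ge> - min (l i) 0"
      using key m(1) unfolding sum_negf by linarith
    then show ?thesis
      using le_m[OF i] l1 by (auto simp: min_def split: if_splits)
  qed
  ultimately show ?thesis
    unfolding suleimanova_condition_def using l by (auto simp: n_def)
qed

lemma antimono_on_nth:
  fixes xs :: "'a::order list"
  assumes "sorted_wrt (\<ge>) xs"
  shows "antimono_on {1..length xs} (\<lambda>i. xs ! (i - 1))"
proof (rule monotone_onI)
  fix i j
  assume ij: "i \<in> {1..length xs}" "j \<in> {1..length xs}" "i \<le> j"
  show "xs ! (j - 1) \<le> xs ! (i - 1)"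
  proof (cases "i = j")
    case False
    then have "i - 1 < j - 1" "j - 1 < length xs"
      using ij by auto
    then show ?thesis
      using assms sorted_wrt_nth_less by blast
  qed auto
qed

lemma condition_C_imp_salzmann_condition:
  assumes "\<Lambda> \<noteq> {#}" "condition_C \<Lambda>"
  shows "salzmann_condition \<Lambda>"
proof -
  obtain x M where s: "sum_mset \<Lambda> \<ge> 0" and M: "\<Lambda> = add_mset x M"
    and M_le: "\<forall>y\<in>#M. real (size \<Lambda>) * y \<le> sum_mset \<Lambda>"
    using assms condition_C_iff by blast
  define n where "n = size \<Lambda>"
  define m where "m = sum_mset \<Lambda> / real n"
  have n: "n > 0"
    using assms(1) by (simp add: n_def nonempty_has_size)
  have le_m: "y \<le> m" if "y \<in># M" for y
    using M_le that n by (simp add: m_def n_def field_simps)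
  have x: "m \<le> x"
    using first_ge_mean[of M x] M_le n by (simp add: M m_def n_def field_simps)
  \<comment> \<open>Putting \<open>x\<close> in front of the decreasing \<open>ys\<close> keeps the
    order, because the mean \<open>m\<close> separates \<open>x\<close> from
    \<open>M\<close>.\<close>
  define ys where "ys = rev (sorted_list_of_multiset M)"
  define l where "l = (\<lambda>i. (x # ys) ! (i - 1))"
  have ys: "mset ys = M" "sorted_wrt (\<ge>) ys"
    by (simp_all add: ys_def sorted_wrt_rev)
  have xys: "mset (x # ys) = \<Lambda>" "length (x # ys) = n"
    using ys(1) M by (simp_all add: n_def flip: size_mset)
  have l: "indexing \<Lambda> l"
    using indexing_nth[of "x # ys"] xys(1) by (simp add: l_def)
  have "\<forall>y\<in>set ys. y \<le> x"
    using le_m x ys(1) by fastforce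
  then have anti: "antimono_on {1..n} l"
    using antimono_on_nth[of "x # ys"] ys(2) xys(2) by (simp add: l_def)
  have l_le: "l i \<le> m" if "2 \<le> i" "i \<le> n" for i
  proof -
    have "l i = ys ! (i - 2)" "i - 2 < length ys"
      using that xys(2) by (auto simp: l_def nth_Cons' numeral_2_eq_2)
    then show ?thesis
      using ys(1) le_m by (metis nth_mem_mset)
  qed
  have "l k + l (n - k + 1) \<le> 2 / real n * (\<Sum>i=1..n. l i)" if "k \<in> {2..(n + 1) div 2}" for k
  proof -
    \<comment> \<open>The range of \<open>k\<close> forces \<open>n \<ge> 3\<close>, so
      \<open>n - k + 1\<close> also lies between 2 and \<open>n\<close>.\<close>
    have "l k \<le> m" "l (n - k + 1) \<le> m"
      using that by (auto intro!: l_le)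
    then show ?thesis
      using indexing_sum[OF l] by (simp add: m_def n_def)
  qed
  then show ?thesis
    unfolding salzmann_condition_def Let_def using l anti s indexing_sum[OF l]
    by (auto simp: n_def)
qed

section \<open>The separating lists\<close>

lemma indexing_3_1_m1_m1:
  "indexing {#3, 1, -1, -1#} (\<lambda>i. [3, 1, -1, -1] ! (i - 1))"
  using indexing_nth[of "[3, 1, -1, -1]"] by simp

lemma atLeastAtMost_1_4: "{1..4::nat} = {1, 2, 3, 4}" "{2..4::nat} = {2, 3, 4}"
  by auto

text \<open>Both 3 and 1 exceed the mean 1/2, but only one element is exempt.\<close>

lemma not_condition_C_3_1_m1_m1: "\<not> condition_C {#3, 1, -1, -1#}"
proof
  assume "condition_C {#3, 1, -1, -1#}"
  then obtain x :: real and M where M: "add_mset x M = {#3, 1, -1, -1#}" "\<forall>y\<in>#M. 4 * y \<le> 2"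
    using condition_C_iff[of "{#3, 1, -1, -1#}"] by auto
  have "3 \<in># add_mset x M" "1 \<in># add_mset x M"
    unfolding M(1) by simp_all
  then have "x = 3 \<or> 3 \<in># M" "x = 1 \<or> 1 \<in># M"
    by auto
  then show False
    using bspec[OF M(2), of 3] bspec[OF M(2), of 1] by linarith
qed

lemma not_suleimanova_spectrum_3_1_m1_m1: "\<not> suleimanova_spectrum {#3, 1, -1, -1#}"
  by (simp add: suleimanova_spectrum_def)

text \<open>The bound is 3/3 = 1, attained by every element other than 3.\<close>

lemma ciarlet_condition_3_1_m1_m1: "ciarlet_condition {#3, 1, -1, -1#}"
proof -
  have "size {#3, 1, -1, -1::real#} = 4"
    by simp
  then show ?thesis
    unfolding ciarlet_condition_def
    by (intro exI[of _ "\<lambda>i. [3, 1, -1, -1] ! (i - 1)"] conjI indexing_3_1_m1_m1)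
      (simp_all only: atLeastAtMost_1_4, simp_all)
qed

lemma suleimanova_condition_3_1_m1_m1: "suleimanova_condition {#3, 1, -1, -1#}"
proof -
  let ?l = "\<lambda>i. [3, 1, -1, -1::real] ! (i - 1)"
  have "{i. i \<in> {1..4} \<and> ?l i < 0} = {3, 4}"
    unfolding atLeastAtMost_1_4 by auto
  then have "(\<Sum>i | i \<in> {1..4} \<and> ?l i < 0. ?l i) = -2"
    by (simp only:) simp
  moreover have "\<forall>i\<in>{1..4}. ?l 1 \<ge> \<bar>?l i\<bar>"
    unfolding atLeastAtMost_1_4 by simp
  moreover have size: "size {#3, 1, -1, -1::real#} = 4"
    by simp
  ultimately show ?thesis
    unfolding suleimanova_condition_def size
    by (intro exI[of _ ?l] conjI indexing_3_1_m1_m1) simp_all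
qed

lemma salzmann_condition_3_1_m1_m1: "salzmann_condition {#3, 1, -1, -1#}"
proof -
  let ?l = "\<lambda>i. [3, 1, -1, -1::real] ! (i - 1)"
  have "antimono_on {1..4} ?l"
    using antimono_on_nth[of "[3, 1, -1, -1::real]"] by (simp add: numeral_eq_Suc)
  moreover have "(\<Sum>i=1..4. ?l i) = 2"
    unfolding atLeastAtMost_1_4 by simp
  \<comment> \<open>The only pair is 1 and -1, with sum 0 below the bound 2/4 * 2 = 1.\<close>
  moreover have "{2..(4 + 1) div 2} = {2::nat}"
    by simp
  moreover have size: "size {#3, 1, -1, -1::real#} = 4"
    by simp
  ultimately show ?thesis
    unfolding salzmann_condition_def Let_def size
    by (intro exI[of _ ?l] conjI indexing_3_1_m1_m1) simp_all
qed

lemma perfect_condition_1_3_1_m1_m1: "perfect_condition_1 {#3, 1, -1, -1#}"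
  unfolding perfect_condition_1_def
  \<comment> \<open>One block consisting of 1 and -1, with 3 in front and the second -1 as
    \<open>\<delta>\<close>; both sums required to be nonpositive are 0.\<close>
  by (rule exI[of _ 1], rule exI[of _ "\<lambda>_. 1"], rule exI[of _ "\<lambda>j. if j = 0 then 3 else 1"],
      rule exI[of _ "\<lambda>_ _. -1"], rule exI[of _ "-1"]) simp

lemma condition_C_1_1: "condition_C {#1, 1#}"
  by (subst condition_C_iff) (auto intro!: exI[of _ 1] exI[of _ "{#1#}"])

lemma not_suleimanova_spectrum_1_1: "\<not> suleimanova_spectrum {#1, 1#}"
  by (simp add: suleimanova_spectrum_def)

lemma not_perfect_condition_1_1_1: "\<not> perfect_condition_1 {#1, 1#}"
proof
  assume "perfect_condition_1 {#1, 1#}"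
  then obtain N :: "real multiset" and \<delta> where "{#1, 1#} = N + {#\<delta>#}" "\<delta> \<le> 0"
    unfolding perfect_condition_1_def by blast
  then have "\<delta> \<in># {#1, 1#}"
    by simp
  then show False
    using \<open>\<delta> \<le> 0\<close> by simp
qed

lemma suleimanova_spectrum_1_m1_0: "suleimanova_spectrum {#1, -1, 0#}"
  by (simp add: suleimanova_spectrum_def)

text \<open>One of 1 and -1 is not \<open>l 1\<close>, and its absolute value 1 exceeds
  \<open>l 1 / 2 \<le> 1/2\<close>.\<close>

lemma not_ciarlet_condition_1_m1_0: "\<not> ciarlet_condition {#1, -1, 0#}"
proof
  let ?L = "{#1, -1, 0 :: real#}"
  assume "ciarlet_condition ?L"
  then obtain l where l: "indexing ?L l" "\<forall>i\<in>{2..3}. \<bar>l i\<bar> \<le> l 1 / 2"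
    by (auto simp: ciarlet_condition_def numeral_3_eq_3)
  define M where "M = image_mset l (mset_set {2..3})"
  have L: "?L = add_mset (l 1) M"
    using indexing_split_first[OF l(1)] by (simp add: M_def numeral_3_eq_3)
  have M: "\<bar>y\<bar> \<le> l 1 / 2" if "y \<in># M" for y
    using l(2) that by (auto simp: M_def)
  have "l 1 \<in># ?L"
    unfolding L by simp
  then have "l 1 \<le> 1"
    by auto
  moreover have "1 \<in># add_mset (l 1) M" "-1 \<in># add_mset (l 1) M"
    unfolding L[symmetric] by simp_all
  ultimately show False
    using M[of 1] M[of "-1"] by auto
qed

theorem theorem5p6:
  "mutually_independent condition_C ciarlet_condition \<and>
   mutually_independent condition_C perfect_condition_1 \<and>
   mutually_independent suleimanova_spectrum ciarlet_condition \<and>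
   strictly_implies suleimanova_spectrum condition_C \<and>
   strictly_implies condition_C suleimanova_condition \<and>
   strictly_implies condition_C salzmann_condition"
proof -
  have nonempty: "{#3, 1, -1, -1::real#} \<noteq> {#}" "{#1, 1::real#} \<noteq> {#}" "{#1, -1, 0::real#} \<noteq> {#}"
    by simp_all
  note C_1_m1_0 = suleimanova_spectrum_imp_condition_C[OF nonempty(3) suleimanova_spectrum_1_m1_0]
  show ?thesis
    unfolding mutually_independent_def strictly_implies_def
    using nonempty C_1_m1_0 not_condition_C_3_1_m1_m1 not_suleimanova_spectrum_3_1_m1_m1
      ciarlet_condition_3_1_m1_m1 suleimanova_condition_3_1_m1_m1 salzmann_condition_3_1_m1_m1
      perfect_condition_1_3_1_m1_m1 condition_C_1_1 not_suleimanova_spectrum_1_1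
      not_perfect_condition_1_1_1 suleimanova_spectrum_1_m1_0 not_ciarlet_condition_1_m1_0
      suleimanova_spectrum_imp_condition_C condition_C_imp_suleimanova_condition
      condition_C_imp_salzmann_condition
    by (intro conjI) blast+
qed

end
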